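(* There exists an absolute constant $C>0$ such that the following holds. Let $T>0$ and suppose that the functions $f^{11},f^{12},f^{21},f^{22},G^1,G^2$ of $(t,x)$, $t\in[0,T]$, $x\in\mathbb{R}$, are all periodic in $x$ with period $1$ and satisfy $$\partial_t f^{11}+\partial_x f^{12}=G^1,\qquad \partial_t f^{21}-\partial_x f^{22}=G^2 .$$ Then $$\begin{aligned} \int_0^T\!\!\int_0^1 \left(f^{11}f^{22}+f^{12}f^{21}\right)dx\,dt\ \leq\ C\Bigg[&\left(\|f^{11}(0)\|_{L^1}+\sup_{0\leq t\leq T}\|f^{11}(t)\|_{L^1}+\int_0^T\!\!\int_0^1|G^1|\,dx\,dt\right)\\ &\cdot\left(\|f^{21}(0)\|_{L^1}+\sup_{0\leq t\leq T}\|f^{21}(t)\|_{L^1}+\int_0^T\!\!\int_0^1|G^2|\,dx\,dt\right)\\ &+\int_0^T\left(\int_0^1 f^{11}dx\int_0^1 f^{22}dx+\int_0^1 f^{12}dx\int_0^1 f^{21}dx\right)dt\Bigg], \end{aligned}$$ provided that the right-hand side is bounded.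
   Context: $f(t)$ denotes the function $x\mapsto f(t,x)$, and $\|f(t)\|_{L^1}=\int_0^1|f(t,x)|\,dx$ is the $L^1$ norm over one period. *)

theory Defs
  imports "HOL-Analysis.Analysis"
begin

definition partial_t :: "(real \<Rightarrow> real \<Rightarrow> real) \<Rightarrow> real \<Rightarrow> real \<Rightarrow> real" where
  "partial_t f t x = deriv (\<lambda>s. f s x) t"

definition partial_x :: "(real \<Rightarrow> real \<Rightarrow> real) \<Rightarrow> real \<Rightarrow> real \<Rightarrow> real" where
  "partial_x f t x = deriv (\<lambda>y. f t y) x"

(* Regularity of a classical solution: continuity up to t = 0 and t = T, but differentiability,
   and continuity of the derivative, only for 0 < t < T, and only in the one variable in which
   the equation differentiates the function.  The derivative may blow up as t tends to 0 or T. *)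

definition classical_t :: "real \<Rightarrow> (real \<Rightarrow> real \<Rightarrow> real) \<Rightarrow> bool" where
  "classical_t T f \<longleftrightarrow>
     continuous_on ({0..T} \<times> UNIV) (\<lambda>(t, x). f t x) \<and>
     (\<forall>t\<in>{0<..<T}. \<forall>x. (\<lambda>s. f s x) field_differentiable at t) \<and>
     continuous_on ({0<..<T} \<times> UNIV) (\<lambda>(t, x). partial_t f t x)"

definition classical_x :: "real \<Rightarrow> (real \<Rightarrow> real \<Rightarrow> real) \<Rightarrow> bool" where
  "classical_x T f \<longleftrightarrow>
     continuous_on ({0..T} \<times> UNIV) (\<lambda>(t, x). f t x) \<and>
     (\<forall>t\<in>{0<..<T}. \<forall>x. (\<lambda>y. f t y) field_differentiable at x) \<and>
     continuous_on ({0<..<T} \<times> UNIV) (\<lambda>(t, x). partial_x f t x)"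

definition periodic_x :: "real \<Rightarrow> (real \<Rightarrow> real \<Rightarrow> real) \<Rightarrow> bool" where
  "periodic_x T f \<longleftrightarrow> (\<forall>t\<in>{0..T}. \<forall>x. f t (x + 1) = f t x)"

definition L1norm :: "(real \<Rightarrow> real) \<Rightarrow> real" where
  "L1norm g = (LINT x:{0..1}|lborel. \<bar>g x\<bar>)"

(* Finiteness of every term of the right-hand side of the estimate.  The integrals of G1 and G2
   are tested with the extended-valued integral, since the real-valued one is 0 for
   non-integrable functions. *)
definition rhs_finite ::
  "real \<Rightarrow> (real \<Rightarrow> real \<Rightarrow> real) \<Rightarrow> (real \<Rightarrow> real \<Rightarrow> real) \<Rightarrow> (real \<Rightarrow> real \<Rightarrow> real) \<Rightarrow>
   (real \<Rightarrow> real \<Rightarrow> real) \<Rightarrow> (real \<Rightarrow> real \<Rightarrow> real) \<Rightarrow> (real \<Rightarrow> real \<Rightarrow> real) \<Rightarrow> bool" where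
  "rhs_finite T f11 f12 f21 f22 G1 G2 \<longleftrightarrow>
     bdd_above ((\<lambda>t. L1norm (f11 t)) ` {0..T}) \<and>
     bdd_above ((\<lambda>t. L1norm (f21 t)) ` {0..T}) \<and>
     (\<integral>\<^sup>+t\<in>{0..T}. (\<integral>\<^sup>+x\<in>{0..1}. ennreal \<bar>G1 t x\<bar> \<partial>lborel) \<partial>lborel) < \<infinity> \<and>
     (\<integral>\<^sup>+t\<in>{0..T}. (\<integral>\<^sup>+x\<in>{0..1}. ennreal \<bar>G2 t x\<bar> \<partial>lborel) \<partial>lborel) < \<infinity> \<and>
     set_integrable lborel {0..T}
       (\<lambda>t. (LINT x:{0..1}|lborel. f11 t x) * (LINT x:{0..1}|lborel. f22 t x) +
            (LINT x:{0..1}|lborel. f12 t x) * (LINT x:{0..1}|lborel. f21 t x))"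

end

theory Submission
  imports Defs
begin

text \<open>
  The estimate comes from a quadratic interaction functional. Let \<open>K\<close> be the
  1-periodic sawtooth with \<open>K z = 1/2 - z\<close> for \<open>0 < z < 1\<close>, so that \<open>K' = \<delta> - 1\<close> on the circle, and put
  \<open>Q t = \<integral>\<integral> K (x - y) f11(t, x) f21(t, y) dx dy\<close> over one period in each variable. Inserting the two
  equations into \<open>Q'\<close> and moving the \<open>x\<close>-derivatives of the fluxes onto \<open>K\<close>, the \<open>\<delta>\<close> in \<open>K'\<close> produces
  the products \<open>f11 f22 + f12 f21\<close> on the diagonal, and the \<open>-1\<close> produces the products of the means:
  \<open>Q' = \<integral> (f11 f22 + f12 f21) - (\<integral> f11 \<integral> f22 + \<integral> f12 \<integral> f21) + E\<close>, where \<open>E\<close> collects the terms containing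
  \<open>G1\<close> and \<open>G2\<close>. The mean terms enter with coefficient exactly 1 and have no sign; the constant of the
  theorem is therefore 1.

  Since \<open>\<bar>K\<bar> \<le> 1/2\<close>, \<open>\<bar>Q\<bar>\<close> is at most half a product of two \<open>L\<^sup>1\<close> norms, and \<open>\<bar>E\<bar>\<close> half a sum of two such
  products (\<open>sawtooth_corr_bound\<close>). Integrating the identity over \<open>[0, T]\<close> gives \<open>interaction_estimate\<close>, whose
  right-hand side is dominated by the product in the theorem.

  The substitution \<open>x = y + z\<close> turns \<open>Q\<close> into an integral of \<open>(1/2 - z) f11(t, y + z) f21(t, y)\<close> over
  the unit square. This kernel is smooth there, so the jump of \<open>K\<close> reappears only as the boundary term
  of an integration by parts (\<open>integral_sawtooth_deriv\<close>), and periodicity makes the functional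
  antisymmetric (\<open>sawtooth_corr_antisym\<close>), which reduces derivatives falling on the second factor to
  those falling on the first.
\<close>

section \<open>Periodic functions and integrals over the unit square\<close>

lemma integral_period_shift:
  fixes f :: "real \<Rightarrow> real"
  assumes f: "continuous_on UNIV f" and per: "\<And>x. f (x + 1) = f x" and y: "0 \<le> y" "y \<le> 1"
  shows "integral {0..1} (\<lambda>z. f (y + z)) = integral {0..1} f"
proof -
  have int: "f integrable_on {a..b}" for a b
    by (rule integrable_continuous_interval[OF continuous_on_subset[OF f]]) simp
  have "integral {0..1} (\<lambda>z. f (y + z)) = integral {y..y + 1} f"
    using integral_shift[of 0 y 1 f, OF continuous_on_subset[OF f]]
    by (simp add: o_def add.commute)
  moreover have "integral {1..y + 1} f = integral {0..y} f"
    using integral_shift[of 0 1 y f, OF continuous_on_subset[OF f]]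
    by (simp add: o_def per)
  moreover have "integral {0..y} f + integral {y..y + 1} f = integral {0..y + 1} f"
    "integral {0..1} f + integral {1..y + 1} f = integral {0..y + 1} f"
    using y by (simp_all add: Henstock_Kurzweil_Integration.integral_combine int)
  ultimately show ?thesis
    by simp
qed

lemma integral_reflect_unit_interval:
  fixes f :: "real \<Rightarrow> real"
  assumes f: "continuous_on UNIV f"
  shows "integral {0..1} (\<lambda>z. f (1 - z)) = integral {0..1} f"
proof -
  have "integral {0..1} (\<lambda>z. f (1 - z)) = integral {-1..0} (\<lambda>z. f (1 + z))"
    using Henstock_Kurzweil_Integration.integral_reflect_real[of 0 "-1" "\<lambda>z. f (1 + z)"]
    by simp
  also have "\<dots> = integral {0..1} f"
    using integral_shift[of "-1" 1 0 f, OF continuous_on_subset[OF f]]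
    by (simp add: o_def add.commute)
  finally show ?thesis .
qed

lemma integral_swap_unit_square:
  fixes F :: "real \<Rightarrow> real \<Rightarrow> real"
  assumes "continuous_on UNIV (\<lambda>(y, z). F y z)"
  shows "integral {0..1} (\<lambda>y. integral {0..1} (F y)) = integral {0..1} (\<lambda>z. integral {0..1} (\<lambda>y. F y z))"
  using integral_swap_continuous[of 0 0 1 1 F, OF continuous_on_subset[OF assms]] by simp

lemma continuous_on_integral_unit:
  fixes F :: "'a::topological_space \<Rightarrow> real \<Rightarrow> real"
  assumes "continuous_on (U \<times> {0..1}) (\<lambda>(y, z). F y z)"
  shows "continuous_on U (\<lambda>y. integral {0..1} (F y))"
  using integral_continuous_on_param[of U 0 1 F] assms by simp

lemma deriv_periodic:
  fixes f :: "real \<Rightarrow> real"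
  assumes "\<And>x. f (x + 1) = f x"
  shows "deriv f (x + 1) = deriv f x"
  by (simp add: deriv_def DERIV_shift assms)

section \<open>The sawtooth correlation\<close>

text \<open>For a 1-periodic \<open>f\<close> this is \<open>\<integral>\<integral> K (x - y) f x g y dx dy\<close> with the periodic sawtooth \<open>K\<close>. It is
  written in the variable \<open>z = x - y\<close> so that the integrand is continuous on the unit square.\<close>

definition sawtooth_corr :: "(real \<Rightarrow> real) \<Rightarrow> (real \<Rightarrow> real) \<Rightarrow> real" where
  "sawtooth_corr f g =
     integral {0..1} (\<lambda>y. integral {0..1} (\<lambda>z. (1/2 - z) * f (y + z) * g y))"

lemma continuous_on_slice:
  assumes "continuous_on UNIV f" "continuous_on S u"
  shows "continuous_on S (\<lambda>p. f (u p))"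
  using continuous_on_compose2[OF assms] by simp

lemma sawtooth_corr_inner_integrable:
  fixes f g :: "real \<Rightarrow> real"
  assumes f: "continuous_on UNIV f" and g: "continuous_on UNIV g"
  shows "(\<lambda>z. (1/2 - z) * f (y + z) * g y) integrable_on {0..1}"
    and "(\<lambda>y. integral {0..1} (\<lambda>z. (1/2 - z) * f (y + z) * g y)) integrable_on {0..1}"
proof -
  note ci = continuous_intros continuous_on_slice[OF f] continuous_on_slice[OF g]
  show "(\<lambda>z. (1/2 - z) * f (y + z) * g y) integrable_on {0..1}"
    by (intro integrable_continuous_interval ci)
  show "(\<lambda>y. integral {0..1} (\<lambda>z. (1/2 - z) * f (y + z) * g y)) integrable_on {0..1}"
    by (intro integrable_continuous_interval continuous_on_integral_unit,
        simp add: split_beta, intro ci)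
qed

lemma sawtooth_corr_add_left:
  assumes "continuous_on UNIV f" "continuous_on UNIV f'" "continuous_on UNIV g"
  shows "sawtooth_corr (\<lambda>x. f x + f' x) g = sawtooth_corr f g + sawtooth_corr f' g"
proof -
  note int = sawtooth_corr_inner_integrable[OF assms(1,3)]
  note int' = sawtooth_corr_inner_integrable[OF assms(2,3)]
  have "integral {0..1} (\<lambda>z. (1/2 - z) * (f (y + z) + f' (y + z)) * g y)
      = integral {0..1} (\<lambda>z. (1/2 - z) * f (y + z) * g y)
        + integral {0..1} (\<lambda>z. (1/2 - z) * f' (y + z) * g y)" for y
    using integral_add[OF int(1)[of y] int'(1)[of y]]
    by (simp only: distrib_left distrib_right)
  then show ?thesis
    unfolding sawtooth_corr_def using integral_add[OF int(2) int'(2)] by simp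
qed

text \<open>The kernel is odd. In the coordinates used here, reversing its argument is \<open>z = 1 - w\<close>; shifting
  \<open>y\<close> by \<open>w\<close> then makes \<open>f\<close> the unshifted factor, and both steps stay on the unit square because \<open>f\<close> and
  \<open>g\<close> are periodic.\<close>

lemma sawtooth_corr_antisym:
  assumes f: "continuous_on UNIV f" and g: "continuous_on UNIV g"
    and perf: "\<And>x. f (x + 1) = f x" and perg: "\<And>x. g (x + 1) = g x"
  shows "sawtooth_corr f g = - sawtooth_corr g f"
proof -
  note ci = continuous_intros continuous_on_slice[OF f] continuous_on_slice[OF g]
  have "sawtooth_corr f g = integral {0..1} (\<lambda>y. integral {0..1} (\<lambda>w. (w - 1/2) * f (y + (1 - w)) * g y))"
    unfolding sawtooth_corr_def
  proof (rule arg_cong[where f = "integral {0..1}"], rule ext)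
    fix y
    show "integral {0..1} (\<lambda>z. (1/2 - z) * f (y + z) * g y)
        = integral {0..1} (\<lambda>w. (w - 1/2) * f (y + (1 - w)) * g y)"
      by (subst integral_reflect_unit_interval[symmetric])
         (intro ci, simp add: algebra_simps)
  qed
  also have "\<dots> = integral {0..1} (\<lambda>w. integral {0..1} (\<lambda>y. (w - 1/2) * f (y + (1 - w)) * g y))"
    by (rule integral_swap_unit_square, simp add: split_beta, intro ci)
  also have "\<dots> = integral {0..1} (\<lambda>w. integral {0..1} (\<lambda>y. - ((1/2 - w) * g (y + w) * f y)))"
  proof (rule integral_cong)
    fix w :: real assume w: "w \<in> {0..1}"
    have "f (x + 1 + (1 - w)) = f (x + (1 - w))" for x
      using perf[of "x + (1 - w)"] by (simp add: algebra_simps)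
    then have "integral {0..1} (\<lambda>y. (w - 1/2) * f (y + (1 - w)) * g y)
      = integral {0..1} (\<lambda>y. (w - 1/2) * f (w + y + (1 - w)) * g (w + y))"
      using w by (subst integral_period_shift[symmetric, of _ w]) (auto simp: perg intro!: ci)
    also have "\<dots> = integral {0..1} (\<lambda>y. - ((1/2 - w) * g (y + w) * f y))"
      by (rule integral_cong) (simp add: perf algebra_simps)
    finally show "integral {0..1} (\<lambda>y. (w - 1/2) * f (y + (1 - w)) * g y)
      = integral {0..1} (\<lambda>y. - ((1/2 - w) * g (y + w) * f y))" .
  qed
  also have "\<dots> = integral {0..1} (\<lambda>y. integral {0..1} (\<lambda>w. - ((1/2 - w) * g (y + w) * f y)))"
    by (rule integral_swap_unit_square, simp add: split_beta, intro ci)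
  also have "\<dots> = - sawtooth_corr g f"
    unfolding sawtooth_corr_def by simp
  finally show ?thesis .
qed

text \<open>The kernel is at most \<open>1/2\<close> in absolute value; periodicity of \<open>f\<close> makes the inner integral of
  \<open>\<bar>f (y + z)\<bar>\<close> independent of \<open>y\<close>, so that the double integral splits.\<close>

lemma sawtooth_corr_bound:
  assumes f: "continuous_on UNIV f" and g: "continuous_on UNIV g"
    and perf: "\<And>x. f (x + 1) = f x"
  shows "\<bar>sawtooth_corr f g\<bar> \<le> 1/2 * integral {0..1} (\<lambda>x. \<bar>f x\<bar>) * integral {0..1} (\<lambda>x. \<bar>g x\<bar>)"
proof -
  note ci = continuous_intros continuous_on_slice[OF f] continuous_on_slice[OF g]
  note int = sawtooth_corr_inner_integrable[OF f g]
  have inner: "\<bar>integral {0..1} (\<lambda>z. (1/2 - z) * f (y + z) * g y)\<bar>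
      \<le> (1/2 * integral {0..1} (\<lambda>x. \<bar>f x\<bar>)) * \<bar>g y\<bar>" if y: "y \<in> {0..1}" for y
  proof -
    have "\<bar>integral {0..1} (\<lambda>z. (1/2 - z) * f (y + z) * g y)\<bar>
        \<le> integral {0..1} (\<lambda>z. (1/2 * \<bar>g y\<bar>) * \<bar>f (y + z)\<bar>)"
      unfolding real_norm_def[symmetric]
    proof (rule integral_norm_bound_integral[OF int(1)])
      show "(\<lambda>z. (1/2 * norm (g y)) * norm (f (y + z))) integrable_on {0..1}"
        by (intro integrable_continuous_interval ci)
      fix z :: real assume "z \<in> {0..1}"
      then have "\<bar>1/2 - z\<bar> \<le> 1/2"
        unfolding atLeastAtMost_iff by linarith
      then have "\<bar>1/2 - z\<bar> * (\<bar>f (y + z)\<bar> * \<bar>g y\<bar>) \<le> 1/2 * (\<bar>f (y + z)\<bar> * \<bar>g y\<bar>)"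
        by (rule mult_right_mono) simp
      then show "norm ((1/2 - z) * f (y + z) * g y) \<le> (1/2 * norm (g y)) * norm (f (y + z))"
        by (simp add: abs_mult mult_ac)
    qed
    also have "\<dots> = (1/2 * \<bar>g y\<bar>) * integral {0..1} (\<lambda>z. \<bar>f (y + z)\<bar>)"
      by simp
    also have "integral {0..1} (\<lambda>z. \<bar>f (y + z)\<bar>) = integral {0..1} (\<lambda>x. \<bar>f x\<bar>)"
      using y by (intro integral_period_shift ci) (auto simp: perf)
    finally show ?thesis by (simp add: mult_ac)
  qed
  have "\<bar>sawtooth_corr f g\<bar> \<le> integral {0..1} (\<lambda>y. (1/2 * integral {0..1} (\<lambda>x. \<bar>f x\<bar>)) * \<bar>g y\<bar>)"
    unfolding sawtooth_corr_def real_norm_def[symmetric]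
    by (rule integral_norm_bound_integral[OF int(2)])
       (use inner in \<open>auto intro!: integrable_continuous_interval ci\<close>)
  then show ?thesis by simp
qed

text \<open>This is \<open>K' = \<delta> - 1\<close> on the circle. Integrating by parts, the weights of the two boundary terms
  are \<open>-1/2\<close> and \<open>-1/2\<close>, and by periodicity both multiply \<open>b y\<close>.\<close>

lemma integral_sawtooth_deriv:
  assumes b': "\<And>x. (b has_real_derivative b' x) (at x)" and cb': "continuous_on UNIV b'"
    and per: "\<And>x. b (x + 1) = b x" and y: "y \<in> {0..1}"
  shows "integral {0..1} (\<lambda>z. (1/2 - z) * b' (y + z)) = integral {0..1} b - b y"
proof -
  have cb: "continuous_on UNIV b"
    by (intro continuous_at_imp_continuous_on ballI DERIV_isCont[OF b'])
  note ci = continuous_intros continuous_on_slice[OF cb] continuous_on_slice[OF cb']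
  have "((\<lambda>z. - b (y + z) + (1/2 - z) * b' (y + z)) has_integral
      (1/2 - 1) * b (y + 1) - (1/2 - 0) * b (y + 0)) {0..1}"
  proof (rule fundamental_theorem_of_calculus)
    fix z :: real
    have "((\<lambda>z. b (y + z)) has_real_derivative b' (y + z)) (at z)"
      using DERIV_shift[of b "b' (y + z)" z y] b'[of "y + z"] by (simp add: add.commute)
    then have "((\<lambda>z. (1/2 - z) * b (y + z)) has_real_derivative
        - b (y + z) + (1/2 - z) * b' (y + z)) (at z)"
      by (auto intro!: derivative_eq_intros)
    then show "((\<lambda>z. (1/2 - z) * b (y + z)) has_vector_derivative
        - b (y + z) + (1/2 - z) * b' (y + z)) (at z within {0..1})"
      by (simp add: has_real_derivative_iff_has_vector_derivative has_vector_derivative_at_within)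
  qed simp
  then have "integral {0..1} (\<lambda>z. - b (y + z) + (1/2 - z) * b' (y + z)) = - b y"
    by (simp add: integral_unique per)
  moreover have "integral {0..1} (\<lambda>z. - b (y + z) + (1/2 - z) * b' (y + z)) =
      integral {0..1} (\<lambda>z. - b (y + z)) + integral {0..1} (\<lambda>z. (1/2 - z) * b' (y + z))"
    by (rule integral_add; intro integrable_continuous_interval ci)
  moreover have "integral {0..1} (\<lambda>z. b (y + z)) = integral {0..1} b"
    using y by (intro integral_period_shift cb) (auto simp: per)
  ultimately show ?thesis by simp
qed

lemma sawtooth_corr_deriv_left:
  assumes b': "\<And>x. (b has_real_derivative b' x) (at x)" and cb': "continuous_on UNIV b'"
    and per: "\<And>x. b (x + 1) = b x" and g: "continuous_on UNIV g"
  shows "sawtooth_corr b' g = integral {0..1} b * integral {0..1} g - integral {0..1} (\<lambda>x. b x * g x)"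
proof -
  have cb: "continuous_on UNIV b"
    by (intro continuous_at_imp_continuous_on ballI DERIV_isCont[OF b'])
  have "sawtooth_corr b' g = integral {0..1} (\<lambda>y. integral {0..1} b * g y - b y * g y)"
    unfolding sawtooth_corr_def
  proof (rule integral_cong)
    fix y :: real assume "y \<in> {0..1}"
    from integral_sawtooth_deriv[OF b' cb' per this]
    show "integral {0..1} (\<lambda>z. (1/2 - z) * b' (y + z) * g y) = integral {0..1} b * g y - b y * g y"
      by (simp only: integral_mult_left flip: left_diff_distrib)
  qed
  also have "\<dots> = integral {0..1} (\<lambda>y. integral {0..1} b * g y) - integral {0..1} (\<lambda>y. b y * g y)"
    by (rule integral_diff; intro integrable_continuous_interval continuous_intros
        continuous_on_slice[OF cb] continuous_on_slice[OF g])
  finally show ?thesis by simp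
qed

text \<open>The form in which a balance law \<open>a' + b' = g\<close> is used: \<open>a'\<close> is the time derivative of a density and
  \<open>b\<close> its flux, which is traded for a pointwise product and a product of means.\<close>

lemma sawtooth_corr_balance:
  assumes b': "\<And>x. (b has_real_derivative b' x) (at x)" and cb': "continuous_on UNIV b'"
    and per: "\<And>x. b (x + 1) = b x"
    and a': "continuous_on UNIV a'" and c: "continuous_on UNIV c"
    and eq: "\<And>x. a' x + b' x = g x"
  shows "sawtooth_corr a' c =
    integral {0..1} (\<lambda>x. b x * c x) - integral {0..1} b * integral {0..1} c + sawtooth_corr g c"
  using sawtooth_corr_add_left[OF a' cb' c] sawtooth_corr_deriv_left[OF b' cb' per c]
  by (simp add: eq)

section \<open>Dependence of the correlation on time\<close>

lemma continuous_on_compose_pair: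
  assumes "continuous_on (I \<times> UNIV) (\<lambda>(t, x). f t x)"
    and "continuous_on S u" "continuous_on S v" "\<And>p. p \<in> S \<Longrightarrow> u p \<in> I"
  shows "continuous_on S (\<lambda>p. f (u p) (v p))"
  using continuous_on_compose2[OF assms(1) continuous_on_Pair[OF assms(2,3)]] assms(4)
  by (simp add: image_subset_iff)

lemma continuous_on_time_slice:
  assumes f: "continuous_on (I \<times> UNIV) (\<lambda>(t, x). f t x)" and "t \<in> I"
  shows "continuous_on S (f t)"
  using continuous_on_compose_pair[OF f continuous_on_const continuous_on_id, of S t] assms(2) by simp

lemma sawtooth_corr_continuous_param:
  assumes f: "continuous_on (I \<times> UNIV) (\<lambda>(t, x). f t x)"
    and g: "continuous_on (I \<times> UNIV) (\<lambda>(t, x). g t x)"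
  shows "continuous_on I (\<lambda>t. sawtooth_corr (f t) (g t))"
  unfolding sawtooth_corr_def
proof (rule continuous_on_integral_unit)
  have "continuous_on ((I \<times> {0..1}) \<times> {0..1}) (\<lambda>((t, y), z). (1/2 - z) * f t (y + z) * g t y)"
    unfolding split_beta
    by (intro continuous_intros continuous_on_compose_pair[OF f] continuous_on_compose_pair[OF g]) auto
  then have "continuous_on ((I \<times> {0..1}) \<times> {0..1})
      (\<lambda>(p, z). (1/2 - z) * f (fst p) (snd p + z) * g (fst p) (snd p))"
    by (simp add: split_beta)
  from continuous_on_integral_unit[OF this]
  show "continuous_on (I \<times> {0..1})
     (\<lambda>(t, y). integral {0..1} (\<lambda>z. (1/2 - z) * f t (y + z) * g t y))"
    by (simp add: split_beta)
qed

text \<open>As a single integral over a compact box, the correlation can be differentiated under the integral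
  sign in one step.\<close>

lemma sawtooth_corr_eq_integral_square:
  assumes f: "continuous_on UNIV f" and g: "continuous_on UNIV g"
  shows "sawtooth_corr f g =
    integral (cbox (0, 0) (1, 1)) (\<lambda>p. (1/2 - snd p) * f (fst p + snd p) * g (fst p))"
proof -
  let ?F = "\<lambda>p. (1/2 - snd p) * f (fst p + snd p) * g (fst p)"
  have "continuous_on (cbox (0, 0) (1, 1)) ?F"
    by (intro continuous_intros continuous_on_slice[OF f] continuous_on_slice[OF g])
  from integral_prod_continuous[OF this] show ?thesis
    by (simp add: sawtooth_corr_def)
qed

lemma sawtooth_corr_has_derivative:
  fixes f g f' g' :: "real \<Rightarrow> real \<Rightarrow> real"
  assumes I: "open I" "convex I" "t \<in> I"
    and f: "continuous_on (I \<times> UNIV) (\<lambda>(t, x). f t x)"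
    and g: "continuous_on (I \<times> UNIV) (\<lambda>(t, x). g t x)"
    and f': "continuous_on (I \<times> UNIV) (\<lambda>(t, x). f' t x)"
    and g': "continuous_on (I \<times> UNIV) (\<lambda>(t, x). g' t x)"
    and df: "\<And>s x. s \<in> I \<Longrightarrow> ((\<lambda>s. f s x) has_real_derivative f' s x) (at s)"
    and dg: "\<And>s x. s \<in> I \<Longrightarrow> ((\<lambda>s. g s x) has_real_derivative g' s x) (at s)"
  shows "((\<lambda>t. sawtooth_corr (f t) (g t)) has_real_derivative
      sawtooth_corr (f' t) (g t) + sawtooth_corr (f t) (g' t)) (at t)"
proof -
  note cp = continuous_on_compose_pair[OF f] continuous_on_compose_pair[OF g]
    continuous_on_compose_pair[OF f'] continuous_on_compose_pair[OF g']
  note slice = continuous_on_time_slice[OF f] continuous_on_time_slice[OF g]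
    continuous_on_time_slice[OF f'] continuous_on_time_slice[OF g']
  let ?Q = "\<lambda>f g p. (1/2 - snd p) * f (fst p + snd p) * g (fst p) :: real"
  let ?S = "cbox (0, 0) (1, 1) :: (real \<times> real) set"
  have "((\<lambda>t. integral ?S (?Q (f t) (g t))) has_real_derivative
      integral ?S (\<lambda>p. ?Q (f' t) (g t) p + ?Q (f t) (g' t) p)) (at t within I)"
  proof (rule leibniz_rule_field_derivative)
    fix s p assume s: "s \<in> I"
    have "((\<lambda>s. (1/2 - snd p) * f s (fst p + snd p) * g s (fst p)) has_real_derivative
        (1/2 - snd p) * f' s (fst p + snd p) * g s (fst p)
        + (1/2 - snd p) * f s (fst p + snd p) * g' s (fst p)) (at s)"
      using df[OF s, of "fst p + snd p"] dg[OF s, of "fst p"]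
      by (auto intro!: derivative_eq_intros)
    then show "((\<lambda>s. ?Q (f s) (g s) p) has_real_derivative
        ?Q (f' s) (g s) p + ?Q (f s) (g' s) p) (at s within I)"
      by (rule has_field_derivative_at_within)
  next
    fix s assume "s \<in> I"
    then show "?Q (f s) (g s) integrable_on ?S"
      by (intro integrable_continuous continuous_intros cp) auto
  next
    show "continuous_on (I \<times> ?S) (\<lambda>(s, p). ?Q (f' s) (g s) p + ?Q (f s) (g' s) p)"
      unfolding split_beta by (intro continuous_intros cp) auto
  qed (use I in auto)
  moreover have "integral ?S (\<lambda>p. ?Q (f' t) (g t) p + ?Q (f t) (g' t) p)
      = integral ?S (?Q (f' t) (g t)) + integral ?S (?Q (f t) (g' t))"
    using I(3) by (intro integral_add integrable_continuous continuous_intros cp) auto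
  ultimately have "((\<lambda>t. integral ?S (?Q (f t) (g t))) has_real_derivative
      sawtooth_corr (f' t) (g t) + sawtooth_corr (f t) (g' t)) (at t within I)"
    using I(3) by (simp add: sawtooth_corr_eq_integral_square slice)
  then have "((\<lambda>t. sawtooth_corr (f t) (g t)) has_real_derivative
      sawtooth_corr (f' t) (g t) + sawtooth_corr (f t) (g' t)) (at t within I)"
    by (rule has_field_derivative_transform_within[OF _ zero_less_one I(3)])
       (simp add: sawtooth_corr_eq_integral_square slice)
  then show ?thesis
    by (simp only: at_within_open[OF I(3,1)])
qed

section \<open>Norms and Lebesgue integrals of the data\<close>

lemma set_lborel_integral_continuous:
  fixes f :: "real \<Rightarrow> real"
  assumes "continuous_on {a..b} f"
  shows "(LINT x:{a..b}|lborel. f x) = integral {a..b} f"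
  by (rule set_borel_integral_eq_integral(2)[OF borel_integrable_atLeastAtMost'[OF assms]])

lemma L1norm_eq_integral:
  assumes "continuous_on UNIV g"
  shows "L1norm g = integral {0..1} (\<lambda>x. \<bar>g x\<bar>)"
  unfolding L1norm_def
  by (intro set_lborel_integral_continuous continuous_intros continuous_on_slice[OF assms])

lemma L1norm_nonneg: "0 \<le> L1norm g"
  unfolding L1norm_def set_lebesgue_integral_def by simp

text \<open>On the open time interval the norm is a continuous function of \<open>t\<close>, and finiteness of the
  extended integral makes it integrable. The two end points, where nothing is known about \<open>G\<close>, form a
  null set.\<close>

lemma set_integrable_L1norm:
  fixes G :: "real \<Rightarrow> real \<Rightarrow> real"
  assumes T: "0 < T" and G: "continuous_on ({0<..<T} \<times> UNIV) (\<lambda>(t, x). G t x)"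
    and fin: "(\<integral>\<^sup>+t\<in>{0..T}. (\<integral>\<^sup>+x\<in>{0..1}. ennreal \<bar>G t x\<bar> \<partial>lborel) \<partial>lborel) < \<infinity>"
  shows "set_integrable lborel {0..T} (\<lambda>t. L1norm (G t))"
proof -
  have slice: "continuous_on S (G t)" if "t \<in> {0<..<T}" for t S
    by (rule continuous_on_time_slice[OF G that])
  have inner: "(\<integral>\<^sup>+x\<in>{0..1}. ennreal \<bar>G t x\<bar> \<partial>lborel) = ennreal (L1norm (G t))"
    if t: "t \<in> {0<..<T}" for t
  proof -
    have "set_integrable lborel {0..1} (\<lambda>x. \<bar>G t x\<bar>)"
      by (intro borel_integrable_atLeastAtMost' continuous_intros slice t)
    then show ?thesis
      unfolding L1norm_def set_integrable_def set_lebesgue_integral_def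
      by (subst nn_integral_eq_integral[symmetric])
         (auto intro!: nn_integral_cong split: split_indicator)
  qed
  have "continuous_on {0<..<T} (\<lambda>t. integral {0..1} (\<lambda>x. \<bar>G t x\<bar>))"
    by (rule continuous_on_integral_unit, simp add: split_beta)
       (intro continuous_intros continuous_on_compose_pair[OF G], auto)
  then have "continuous_on {0<..<T} (\<lambda>t. L1norm (G t))"
    by (rule continuous_on_eq) (simp add: L1norm_eq_integral slice)
  then have meas: "(\<lambda>t. indicator {0<..<T} t *\<^sub>R L1norm (G t)) \<in> borel_measurable borel"
    by (intro borel_measurable_continuous_on_indicator) auto
  moreover have "(\<integral>\<^sup>+t. ennreal (indicator {0<..<T} t *\<^sub>R L1norm (G t)) \<partial>lborel)
      \<le> (\<integral>\<^sup>+t\<in>{0..T}. (\<integral>\<^sup>+x\<in>{0..1}. ennreal \<bar>G t x\<bar> \<partial>lborel) \<partial>lborel)"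
    by (intro nn_integral_mono) (auto simp: inner split: split_indicator)
  ultimately have "integrable lborel (\<lambda>t. indicator {0<..<T} t *\<^sub>R L1norm (G t))"
    using fin by (intro integrableI_nonneg) (auto simp: L1norm_nonneg le_less_trans)
  then show ?thesis
    unfolding set_integrable_def
  proof (rule integrable_cong_AE_imp)
    show "(\<lambda>t. indicator {0..T} t *\<^sub>R L1norm (G t)) \<in> borel_measurable lborel"
    proof -
      have "(\<lambda>t. indicator {0..T} t *\<^sub>R L1norm (G t)) = (\<lambda>t. indicator {0<..<T} t *\<^sub>R L1norm (G t)
          + (indicator {0} t * L1norm (G 0) + indicator {T} t * L1norm (G T)))"
        using T by (auto simp: fun_eq_iff split: split_indicator)
      also have "\<dots> \<in> borel_measurable borel"
        by (intro borel_measurable_add meas borel_measurable_times) auto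
      finally show ?thesis by simp
    qed
  next
    show "AE t in lborel. indicator {0<..<T} t *\<^sub>R L1norm (G t) = indicator {0..T} t *\<^sub>R L1norm (G t)"
      using AE_lborel_singleton[of 0] AE_lborel_singleton[of T]
      by eventually_elim (auto split: split_indicator)
  qed
qed

section \<open>The interaction estimate\<close>

text \<open>The derivative of \<open>Q\<close> may be unbounded near \<open>t = 0\<close> and \<open>t = T\<close>. The fundamental theorem for
  the gauge integral only asks for continuity of \<open>Q\<close> there, and the error term \<open>E\<close> is then integrable
  as the difference between \<open>Q'\<close> and a continuous function.\<close>

lemma interaction_estimate:
  fixes f11 f12 f21 f22 G1 G2 :: "real \<Rightarrow> real \<Rightarrow> real"
  assumes T: "0 < T"
    and f11: "classical_t T f11" and f12: "classical_x T f12"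
    and f21: "classical_t T f21" and f22: "classical_x T f22"
    and per: "periodic_x T f11" "periodic_x T f12" "periodic_x T f21" "periodic_x T f22"
      "periodic_x T G1" "periodic_x T G2"
    and eq1: "\<And>t x. t \<in> {0<..<T} \<Longrightarrow> partial_t f11 t x + partial_x f12 t x = G1 t x"
    and eq2: "\<And>t x. t \<in> {0<..<T} \<Longrightarrow> partial_t f21 t x - partial_x f22 t x = G2 t x"
    and fin: "rhs_finite T f11 f12 f21 f22 G1 G2"
  shows "(LINT t:{0..T}|lborel. LINT x:{0..1}|lborel. f11 t x * f22 t x + f12 t x * f21 t x)
      - (LINT t:{0..T}|lborel.
           (LINT x:{0..1}|lborel. f11 t x) * (LINT x:{0..1}|lborel. f22 t x)
           + (LINT x:{0..1}|lborel. f12 t x) * (LINT x:{0..1}|lborel. f21 t x))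
    \<le> 1/2 * (L1norm (f11 0) * L1norm (f21 0)
        + (SUP t\<in>{0..T}. L1norm (f11 t)) * (SUP t\<in>{0..T}. L1norm (f21 t))
        + (LINT t:{0..T}|lborel. L1norm (G1 t)) * (SUP t\<in>{0..T}. L1norm (f21 t))
        + (SUP t\<in>{0..T}. L1norm (f11 t)) * (LINT t:{0..T}|lborel. L1norm (G2 t)))"
proof -
  let ?I = "{0<..<T}"
  let ?m = "\<lambda>f. integral {0..1} f :: real"
  define S1 S2 where "S1 = (SUP t\<in>{0..T}. L1norm (f11 t))" and "S2 = (SUP t\<in>{0..T}. L1norm (f21 t))"

  have c: "continuous_on ({0..T} \<times> UNIV) (\<lambda>(t, x). f11 t x)"
    "continuous_on ({0..T} \<times> UNIV) (\<lambda>(t, x). f12 t x)"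
    "continuous_on ({0..T} \<times> UNIV) (\<lambda>(t, x). f21 t x)"
    "continuous_on ({0..T} \<times> UNIV) (\<lambda>(t, x). f22 t x)"
    using f11 f12 f21 f22 by (auto simp: classical_t_def classical_x_def)
  note ci = continuous_intros c[THEN continuous_on_compose_pair]
  note slice = c[THEN continuous_on_time_slice]
  have c': "continuous_on (?I \<times> UNIV) (\<lambda>(t, x). f11 t x)"
    "continuous_on (?I \<times> UNIV) (\<lambda>(t, x). f21 t x)"
    using c(1,3) by (auto elim!: continuous_on_subset)
  have cd: "continuous_on (?I \<times> UNIV) (\<lambda>(t, x). partial_t f11 t x)"
    "continuous_on (?I \<times> UNIV) (\<lambda>(t, x). partial_x f12 t x)"
    "continuous_on (?I \<times> UNIV) (\<lambda>(t, x). partial_t f21 t x)"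
    "continuous_on (?I \<times> UNIV) (\<lambda>(t, x). partial_x f22 t x)"
    using f11 f12 f21 f22 by (auto simp: classical_t_def classical_x_def)
  note slice' = cd[THEN continuous_on_time_slice]
  have d: "((\<lambda>s. f11 s x) has_real_derivative partial_t f11 t x) (at t)"
    "(f12 t has_real_derivative partial_x f12 t x) (at x)"
    "((\<lambda>s. f21 s x) has_real_derivative partial_t f21 t x) (at t)"
    "(f22 t has_real_derivative partial_x f22 t x) (at x)" if "t \<in> ?I" for t x
    using f11 f12 f21 f22 that
    by (auto simp: classical_t_def classical_x_def partial_t_def partial_x_def
        intro!: field_differentiable_derivI)
  have p: "f11 t (x + 1) = f11 t x" "f12 t (x + 1) = f12 t x"
    "f21 t (x + 1) = f21 t x" "f22 t (x + 1) = f22 t x" if "t \<in> {0..T}" for t x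
    using per that by (auto simp: periodic_x_def)
  have pG: "G1 t (x + 1) = G1 t x" "G2 t (x + 1) = G2 t x" if "t \<in> {0..T}" for t x
    using per that by (auto simp: periodic_x_def)
  have cG1: "continuous_on (?I \<times> UNIV) (\<lambda>(t, x). G1 t x)"
    by (rule continuous_on_eq[OF continuous_on_add[OF cd(1,2)]]) (auto simp: eq1)
  have cG2: "continuous_on (?I \<times> UNIV) (\<lambda>(t, x). G2 t x)"
    by (rule continuous_on_eq[OF continuous_on_diff[OF cd(3,4)]]) (auto simp: eq2)
  note sliceG = continuous_on_time_slice[OF cG1] continuous_on_time_slice[OF cG2]

  have bdd: "bdd_above ((\<lambda>t. L1norm (f11 t)) ` {0..T})" "bdd_above ((\<lambda>t. L1norm (f21 t)) ` {0..T})"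
    and finG: "(\<integral>\<^sup>+t\<in>{0..T}. (\<integral>\<^sup>+x\<in>{0..1}. ennreal \<bar>G1 t x\<bar> \<partial>lborel) \<partial>lborel) < \<infinity>"
      "(\<integral>\<^sup>+t\<in>{0..T}. (\<integral>\<^sup>+x\<in>{0..1}. ennreal \<bar>G2 t x\<bar> \<partial>lborel) \<partial>lborel) < \<infinity>"
    using fin unfolding rhs_finite_def by auto
  have S1: "L1norm (f11 t) \<le> S1" and S2: "L1norm (f21 t) \<le> S2" if "t \<in> {0..T}" for t
    unfolding S1_def S2_def using bdd that by (auto intro: cSUP_upper)
  have S_nonneg: "0 \<le> S1" "0 \<le> S2"
    using S1[of 0] S2[of 0] L1norm_nonneg[of "f11 0"] L1norm_nonneg[of "f21 0"] T by auto
  have bound: "\<bar>sawtooth_corr f g\<bar> \<le> 1/2 * (L1norm f * L1norm g)"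
    if "continuous_on UNIV f" "continuous_on UNIV g" "\<And>x. f (x + 1) = f x" for f g
    using sawtooth_corr_bound[OF that] that by (simp add: L1norm_eq_integral)

  define Q where "Q = (\<lambda>t. sawtooth_corr (f11 t) (f21 t))"
  define h1 where "h1 = (\<lambda>t. ?m (\<lambda>x. f11 t x * f22 t x + f12 t x * f21 t x))"
  define h2 where "h2 = (\<lambda>t. ?m (f11 t) * ?m (f22 t) + ?m (f12 t) * ?m (f21 t))"
  \<comment> \<open>The value 0 at the end points keeps the bound on E valid on the closed interval.\<close>
  define E where "E = (\<lambda>t. if t \<in> ?I
    then sawtooth_corr (G1 t) (f21 t) - sawtooth_corr (G2 t) (f11 t) else 0)"

  have Q': "(Q has_real_derivative h1 t - h2 t + E t) (at t)" if t: "t \<in> ?I" for t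
  proof -
    have t': "t \<in> {0..T}" using t by auto
    have per21: "partial_t f21 t (x + 1) = partial_t f21 t x" for x
      using eq2[OF t, of x] eq2[OF t, of "x + 1"] pG(2)[OF t', of x] deriv_periodic[of "f22 t" x, OF p(4)[OF t']]
      by (simp add: partial_x_def)
    have "sawtooth_corr (partial_t f11 t) (f21 t) =
        ?m (\<lambda>x. f12 t x * f21 t x) - ?m (f12 t) * ?m (f21 t) + sawtooth_corr (G1 t) (f21 t)"
      by (rule sawtooth_corr_balance[OF d(2)[OF t]])
         (use t t' in \<open>auto intro!: slice slice' p eq1\<close>)
    \<comment> \<open>The second family moves in the opposite direction: its flux is - f22.\<close>
    moreover have "sawtooth_corr (partial_t f21 t) (f11 t) =
        ?m (\<lambda>x. - f22 t x * f11 t x) - ?m (\<lambda>x. - f22 t x) * ?m (f11 t) + sawtooth_corr (G2 t) (f11 t)"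
    proof (rule sawtooth_corr_balance[OF DERIV_minus[OF d(4)[OF t]]])
      show "continuous_on UNIV (\<lambda>x. - partial_x f22 t x)"
        by (intro continuous_on_minus slice' t)
      show "partial_t f21 t x + - partial_x f22 t x = G2 t x" for x
        using eq2[OF t] by simp
    qed (use t t' in \<open>auto intro!: slice slice' simp: p\<close>)
    moreover have "sawtooth_corr (f11 t) (partial_t f21 t) = - sawtooth_corr (partial_t f21 t) (f11 t)"
      by (rule sawtooth_corr_antisym[OF slice(1)[OF t'] slice'(3)[OF t] p(1)[OF t'] per21])
    moreover have "h1 t = ?m (\<lambda>x. f11 t x * f22 t x) + ?m (\<lambda>x. f12 t x * f21 t x)"
      unfolding h1_def
      by (intro integral_add integrable_continuous_interval continuous_on_mult slice t')
    ultimately have "sawtooth_corr (partial_t f11 t) (f21 t) + sawtooth_corr (f11 t) (partial_t f21 t)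
        = h1 t - h2 t + E t"
      using t by (simp add: h2_def E_def mult.commute)
    moreover have "(Q has_real_derivative
        sawtooth_corr (partial_t f11 t) (f21 t) + sawtooth_corr (f11 t) (partial_t f21 t)) (at t)"
      unfolding Q_def
      by (rule sawtooth_corr_has_derivative[OF _ _ t c' cd(1,3) d(1) d(3)]) auto
    ultimately show ?thesis by simp
  qed

  have cm: "continuous_on {0..T} (\<lambda>t. ?m (f t))"
    if "continuous_on ({0..T} \<times> UNIV) (\<lambda>(t, x). f t x)" for f :: "real \<Rightarrow> real \<Rightarrow> real"
    by (rule continuous_on_integral_unit) (auto intro: continuous_on_subset[OF that])
  have ch1: "continuous_on {0..T} h1"
    unfolding h1_def by (rule cm) (unfold split_beta, intro ci, auto)
  have ch2: "continuous_on {0..T} h2"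
    unfolding h2_def by (intro continuous_intros cm c)
  have total: "((\<lambda>t. h1 t - h2 t + E t) has_integral Q T - Q 0) {0..T}"
  proof (rule fundamental_theorem_of_calculus_interior)
    show "continuous_on {0..T} Q"
      unfolding Q_def by (rule sawtooth_corr_continuous_param[OF c(1,3)])
  qed (use T Q' in \<open>auto simp: has_real_derivative_iff_has_vector_derivative\<close>)
  have "((\<lambda>t. h1 t - h2 t) has_integral integral {0..T} h1 - integral {0..T} h2) {0..T}"
    by (intro has_integral_diff integrable_integral integrable_continuous_interval ch1 ch2)
  from has_integral_diff[OF total this]
  have Ei: "(E has_integral Q T - Q 0 - (integral {0..T} h1 - integral {0..T} h2)) {0..T}"
    by simp

  have g: "set_integrable lborel {0..T} (\<lambda>t. L1norm (G1 t))"
      "set_integrable lborel {0..T} (\<lambda>t. L1norm (G2 t))"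
    by (intro set_integrable_L1norm T cG1 cG2 finG)+
  note gi = set_borel_integral_eq_integral[OF g(1)] set_borel_integral_eq_integral[OF g(2)]
  have "norm (integral {0..T} E) \<le> integral {0..T} (\<lambda>t. S2/2 * L1norm (G1 t) + S1/2 * L1norm (G2 t))"
  proof (rule integral_norm_bound_integral)
    show "E integrable_on {0..T}" using Ei by blast
    show "(\<lambda>t. S2/2 * L1norm (G1 t) + S1/2 * L1norm (G2 t)) integrable_on {0..T}"
      by (intro integrable_add integrable_on_mult_right gi)
    fix t assume t': "t \<in> {0..T}"
    show "norm (E t) \<le> S2/2 * L1norm (G1 t) + S1/2 * L1norm (G2 t)"
    proof (cases "t \<in> ?I")
      case t: True
      have "\<bar>sawtooth_corr (G1 t) (f21 t)\<bar> \<le> 1/2 * (L1norm (G1 t) * L1norm (f21 t))"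
        by (intro bound sliceG slice t t' pG)
      moreover have "L1norm (G1 t) * L1norm (f21 t) \<le> L1norm (G1 t) * S2"
        by (intro mult_left_mono S2 t' L1norm_nonneg)
      moreover have "\<bar>sawtooth_corr (G2 t) (f11 t)\<bar> \<le> 1/2 * (L1norm (G2 t) * L1norm (f11 t))"
        by (intro bound sliceG slice t t' pG)
      moreover have "L1norm (G2 t) * L1norm (f11 t) \<le> L1norm (G2 t) * S1"
        by (intro mult_left_mono S1 t' L1norm_nonneg)
      ultimately show ?thesis using t by (simp add: E_def mult.commute)
    next
      case False
      then have "E t = 0" by (simp only: E_def if_False)
      then show ?thesis using S_nonneg L1norm_nonneg by simp
    qed
  qed
  also have "\<dots> = S2/2 * (LINT t:{0..T}|lborel. L1norm (G1 t)) + S1/2 * (LINT t:{0..T}|lborel. L1norm (G2 t))"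
    using integral_add[OF integrable_on_mult_right[OF gi(1), of "S2/2"] integrable_on_mult_right[OF gi(3), of "S1/2"]]
    by (simp add: gi(2,4))
  finally have E_bound: "\<bar>Q T - Q 0 - (integral {0..T} h1 - integral {0..T} h2)\<bar>
      \<le> S2/2 * (LINT t:{0..T}|lborel. L1norm (G1 t)) + S1/2 * (LINT t:{0..T}|lborel. L1norm (G2 t))"
    using integral_unique[OF Ei] by simp
  have Q_bound: "\<bar>Q t\<bar> \<le> 1/2 * (L1norm (f11 t) * L1norm (f21 t))" if "t \<in> {0..T}" for t
    unfolding Q_def by (intro bound slice p that)
  note E_bound
  moreover have "L1norm (f11 T) * L1norm (f21 T) \<le> S1 * S2"
    using T by (intro mult_mono S1 S2 L1norm_nonneg S_nonneg) auto
  moreover have "(LINT t:{0..T}|lborel. LINT x:{0..1}|lborel. f11 t x * f22 t x + f12 t x * f21 t x)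
      = integral {0..T} h1"
  proof -
    have "(LINT t:{0..T}|lborel. LINT x:{0..1}|lborel. f11 t x * f22 t x + f12 t x * f21 t x)
        = (LINT t:{0..T}|lborel. h1 t)"
      unfolding h1_def
      by (intro set_lebesgue_integral_cong allI impI set_lborel_integral_continuous
          continuous_on_add continuous_on_mult slice) auto
    then show ?thesis by (simp add: set_lborel_integral_continuous[OF ch1])
  qed
  moreover have "(LINT t:{0..T}|lborel.
        (LINT x:{0..1}|lborel. f11 t x) * (LINT x:{0..1}|lborel. f22 t x)
        + (LINT x:{0..1}|lborel. f12 t x) * (LINT x:{0..1}|lborel. f21 t x))
      = integral {0..T} h2"
  proof -
    have "(LINT t:{0..T}|lborel.
        (LINT x:{0..1}|lborel. f11 t x) * (LINT x:{0..1}|lborel. f22 t x)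
        + (LINT x:{0..1}|lborel. f12 t x) * (LINT x:{0..1}|lborel. f21 t x)) = (LINT t:{0..T}|lborel. h2 t)"
      by (rule set_lebesgue_integral_cong) (auto simp: h2_def set_lborel_integral_continuous slice)
    then show ?thesis by (simp add: set_lborel_integral_continuous[OF ch2])
  qed
  ultimately show ?thesis
    unfolding S1_def[symmetric] S2_def[symmetric] using Q_bound[of 0] Q_bound[of T] T
    by (simp add: algebra_simps)
qed

theorem lemma4p1:
  "\<exists>C::real. C > 0 \<and>
     (\<forall>(T::real) (f11::real \<Rightarrow> real \<Rightarrow> real) (f12::real \<Rightarrow> real \<Rightarrow> real)
        (f21::real \<Rightarrow> real \<Rightarrow> real) (f22::real \<Rightarrow> real \<Rightarrow> real)
        (G1::real \<Rightarrow> real \<Rightarrow> real) (G2::real \<Rightarrow> real \<Rightarrow> real).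
        T > 0 \<longrightarrow>
        classical_t T f11 \<longrightarrow> classical_x T f12 \<longrightarrow> classical_t T f21 \<longrightarrow> classical_x T f22 \<longrightarrow>
        periodic_x T f11 \<longrightarrow> periodic_x T f12 \<longrightarrow> periodic_x T f21 \<longrightarrow> periodic_x T f22 \<longrightarrow>
        periodic_x T G1 \<longrightarrow> periodic_x T G2 \<longrightarrow>
        (\<forall>t\<in>{0<..<T}. \<forall>x. partial_t f11 t x + partial_x f12 t x = G1 t x) \<longrightarrow>
        (\<forall>t\<in>{0<..<T}. \<forall>x. partial_t f21 t x - partial_x f22 t x = G2 t x) \<longrightarrow>
        rhs_finite T f11 f12 f21 f22 G1 G2 \<longrightarrow>
        (LINT t:{0..T}|lborel. LINT x:{0..1}|lborel. f11 t x * f22 t x + f12 t x * f21 t x)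
        \<le> C *
          ((L1norm (f11 0) + (SUP t\<in>{0..T}. L1norm (f11 t))
              + (LINT t:{0..T}|lborel. LINT x:{0..1}|lborel. \<bar>G1 t x\<bar>))
           * (L1norm (f21 0) + (SUP t\<in>{0..T}. L1norm (f21 t))
              + (LINT t:{0..T}|lborel. LINT x:{0..1}|lborel. \<bar>G2 t x\<bar>))
           + (LINT t:{0..T}|lborel.
                (LINT x:{0..1}|lborel. f11 t x) * (LINT x:{0..1}|lborel. f22 t x)
                + (LINT x:{0..1}|lborel. f12 t x) * (LINT x:{0..1}|lborel. f21 t x))))"
proof (intro exI[of _ 1] conjI allI impI)
  fix T :: real and f11 f12 f21 f22 G1 G2 :: "real \<Rightarrow> real \<Rightarrow> real"
  assume T: "T > 0"
    and regular: "classical_t T f11" "classical_x T f12" "classical_t T f21" "classical_x T f22"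
    and per: "periodic_x T f11" "periodic_x T f12" "periodic_x T f21" "periodic_x T f22"
      "periodic_x T G1" "periodic_x T G2"
    and eq: "\<forall>t\<in>{0<..<T}. \<forall>x. partial_t f11 t x + partial_x f12 t x = G1 t x"
      "\<forall>t\<in>{0<..<T}. \<forall>x. partial_t f21 t x - partial_x f22 t x = G2 t x"
    and fin: "rhs_finite T f11 f12 f21 f22 G1 G2"
  have SUP_nonneg: "0 \<le> (SUP t\<in>{0..T}. L1norm (f t))"
    if "bdd_above ((\<lambda>t. L1norm (f t)) ` {0..T})" for f
    using cSUP_upper[OF _ that, of 0] L1norm_nonneg[of "f 0"] T by auto
  have LINT_nonneg: "0 \<le> (LINT t:{0..T}|lborel. L1norm (G t))" for G
    unfolding set_lebesgue_integral_def by (simp add: L1norm_nonneg)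
  have half_le: "1/2 * (a * b + s * r + g * r + s * k) \<le> (a + s + g) * (b + r + k)"
    if "0 \<le> a" "0 \<le> s" "0 \<le> g" "0 \<le> b" "0 \<le> r" "0 \<le> k" for a s g b r k :: real
  proof -
    have "0 \<le> a * b" "0 \<le> a * r" "0 \<le> a * k" "0 \<le> s * b" "0 \<le> s * r" "0 \<le> s * k"
      "0 \<le> g * b" "0 \<le> g * r" "0 \<le> g * k"
      using that by simp_all
    then show ?thesis by (simp add: algebra_simps)
  qed
  show "(LINT t:{0..T}|lborel. LINT x:{0..1}|lborel. f11 t x * f22 t x + f12 t x * f21 t x)
        \<le> 1 *
          ((L1norm (f11 0) + (SUP t\<in>{0..T}. L1norm (f11 t))
              + (LINT t:{0..T}|lborel. LINT x:{0..1}|lborel. \<bar>G1 t x\<bar>))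
           * (L1norm (f21 0) + (SUP t\<in>{0..T}. L1norm (f21 t))
              + (LINT t:{0..T}|lborel. LINT x:{0..1}|lborel. \<bar>G2 t x\<bar>))
           + (LINT t:{0..T}|lborel.
                (LINT x:{0..1}|lborel. f11 t x) * (LINT x:{0..1}|lborel. f22 t x)
                + (LINT x:{0..1}|lborel. f12 t x) * (LINT x:{0..1}|lborel. f21 t x)))"
    (is "?lhs \<le> 1 * (?A * ?B + ?D)")
  proof -
    have "?lhs - ?D \<le> 1/2 * (L1norm (f11 0) * L1norm (f21 0)
        + (SUP t\<in>{0..T}. L1norm (f11 t)) * (SUP t\<in>{0..T}. L1norm (f21 t))
        + (LINT t:{0..T}|lborel. L1norm (G1 t)) * (SUP t\<in>{0..T}. L1norm (f21 t))
        + (SUP t\<in>{0..T}. L1norm (f11 t)) * (LINT t:{0..T}|lborel. L1norm (G2 t)))"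
      using interaction_estimate[OF T regular per _ _ fin] eq by blast
    also have "\<dots> \<le> ?A * ?B"
      unfolding L1norm_def[of "G1 _", symmetric] L1norm_def[of "G2 _", symmetric]
      using fin by (intro half_le L1norm_nonneg SUP_nonneg LINT_nonneg) (auto simp: rhs_finite_def)
    finally show ?thesis by (simp only: diff_le_eq mult_1)
  qed
qed simp

end
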